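(* Let $d\in\{1,2,3\}$, let $\boldsymbol{M}=(M_1,\dots,M_d)$ be such that $\mathcal{F}(\boldsymbol{M})$ is nonempty, and let $M_1<\mu<1$. Then $D_{\min}^{(d)}(\boldsymbol{M},\mu)$ is given as follows. (i) For $d=1$: $$D_{\min}^{(1)}(\boldsymbol{M},\mu)=(1-M_1)\log\frac{1-M_1}{1-\mu}+M_1\log\frac{M_1}{\mu}.$$ (ii) For $d=2$: $$D_{\min}^{(2)}(\boldsymbol{M},\mu)=\frac{(1-M_1)^2}{1-2M_1+M_2}\log\Big(1-\Big(\frac{M_1-M_2}{1-M_1}-\mu\Big)\nu^{(2)}\Big)+\frac{M_2-M_1^2}{1-2M_1+M_2}\log\big(1-(1-\mu)\nu^{(2)}\big),$$ where $$\nu^{(2)}=\frac{(1-M_1)(M_1-\mu)}{(1-M_1)\mu^2-(1-M_2)\mu+M_1-M_2}.$$ (iii) For $d=3$: if $M_1=M_2=M_3$, then $D_{\min}^{(3)}(\boldsymbol{M},\mu)=D_{\min}^{(1)}((M_1),\mu)$, i.e. the expression in (i). Otherwise $$D_{\min}^{(3)}(\boldsymbol{M},\mu)=\sum_{l=1}^3 f_l\log(1-\bar x_l\,\nu^{(3)}),$$ where $$(\bar x_1,\bar x_2,\bar x_3)=\Big(-\mu,\ \frac{M_2-M_3}{M_1-M_2}-\mu,\ 1-\mu\Big),$$ $$f_2=\frac{(M_1-M_2)^3}{(M_2-M_3)(M_1-2M_2+M_3)},\qquad f_3=\frac{M_1M_3-M_2^2}{M_1-2M_2+M_3},\qquad f_1=1-f_2-f_3,$$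 $$\nu^{(3)}=\begin{cases}\dfrac{-b+\sqrt{b^2+4ac}}{2a}, & a\ne 0,\\[2mm] \dfrac{c}{b}, & a=0,\end{cases}$$ with $$a=\bar x_1\bar x_2\bar x_3,\qquad b=(M_2-2\mu M_1+\mu^2)+(\bar x_1+\bar x_2+\bar x_3)(\mu-M_1),\qquad c=\mu-M_1.$$
   Context: $\mathcal{F}$ is the family of all (Borel) probability distributions on $[0,1]$, and $\mathrm{E}_F[\cdot]$ denotes expectation when $X$ has distribution $F$. The Kullback-Leibler divergence is $D(F\Vert G)=\mathrm{E}_F[\log \frac{\mathrm{d}F}{\mathrm{d}G}]$ if the density $\frac{\mathrm{d}F}{\mathrm{d}G}$ exists, and $D(F\Vert G)=+\infty$ otherwise. For $F\in\mathcal{F}$ and $\mu\in[0,1]$, $$D_{\min}(F,\mu)=\min_{G\in\mathcal{F}:\,\mathrm{E}_G[X]\ge\mu} D(F\Vert G).$$ For $\boldsymbol{M}=(M_1,\dots,M_d)$ let $\mathcal{F}(\boldsymbol{M})=\{F\in\mathcal{F}:(\mathrm{E}_F[X],\dots,\mathrm{E}_F[X^d])=\boldsymbol{M}\}$ and $D_{\min}^{(d)}(\boldsymbol{M},\mu)=\inf_{F\in\mathcal{F}(\boldsymbol{M})}D_{\min}(F,\mu)$. Conventions: $\log 0=-\infty$ and $0\cdot\log 0=0$ (a term whose coefficient is zero contributes zero). *)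

theory Defs
  imports "HOL-Probability.Probability"
begin

text \<open>Distributions on the unit interval are Borel probability measures on the reals
  that give the unit interval full mass.\<close>

definition unit_distributions :: "real measure set" where
  "unit_distributions = {F. real_distribution F \<and> measure F {0..1} = 1}"

text \<open>\<open>KL_divergence b G F\<close> is the Bochner integral of the log-density of \<open>F\<close> with respect
  to \<open>G\<close> (note the order of the arguments), hence \<open>0\<close> if that function is not integrable.
  The negative part of the log-density always has finite expectation under \<open>F\<close>
  (\<open>neg_log_density_finite\<close> below), so in the non-integrable case the expectation is
  \<open>\<infinity>\<close>.\<close>

definition KL :: "real measure \<Rightarrow> real measure \<Rightarrow> ereal" where
  "KL F G =
    (if (\<exists>f\<in>borel_measurable G. density G f = F) \<and> integrable F (entropy_density (exp 1) G F)
     then ereal (KL_divergence (exp 1) G F) else \<infinity>)"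

lemma neg_log_density_finite:
  assumes "prob_space G" and "f \<in> borel_measurable G" and F: "density G f = F"
  shows "(\<integral>\<^sup>+x. ennreal (- entropy_density (exp 1) G F x) \<partial>F) < \<infinity>"
proof -
  interpret G: prob_space G by fact
  define r where "r = RN_deriv G F"
  have r [measurable]: "r \<in> borel_measurable G"
    unfolding r_def by simp
  have F': "F = density G r"
    using RN_derivI[OF assms(2,3)] by (simp add: r_def)
  have *: "r x * ennreal (- ln (enn2real (r x))) \<le> 1" for x
  proof (cases "r x")
    case (real t)
    show ?thesis
    proof (cases "t = 0")
      case False
      then have t: "t > 0" using real by simp
      have "- ln t \<le> 1 / t - 1"
        using ln_le_minus_one[of "1 / t"] t by (simp add: ln_div)
      then have "t * (- ln t) \<le> t * (1 / t)"
        using t by (intro mult_left_mono) auto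
      then have "t * (- ln t) \<le> 1" using t by simp
      then have "ennreal (t * (- ln t)) \<le> 1"
        by (metis ennreal_1 ennreal_leI)
      then show ?thesis using real t by (simp add: ennreal_mult'[symmetric] del: mult_minus_right)
    qed (use real in auto)
  qed auto
  have "(\<integral>\<^sup>+x. ennreal (- entropy_density (exp 1) G F x) \<partial>F)
      = (\<integral>\<^sup>+x. r x * ennreal (- ln (enn2real (r x))) \<partial>G)"
    unfolding entropy_density_def r_def[symmetric]
    by (subst F', subst nn_integral_density) (auto simp: log_def)
  also have "\<dots> \<le> (\<integral>\<^sup>+x. 1 \<partial>G)"
    using * by (intro nn_integral_mono) auto
  also have "\<dots> = 1" by (simp add: G.emeasure_space_1)
  finally show ?thesis by (simp add: le_less_trans)
qed

text \<open>The minimum is attained (the divergence is lower semicontinuous and the constraint set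
  is weakly compact), so it is written as an infimum.\<close>

definition D_min :: "real measure \<Rightarrow> real \<Rightarrow> ereal" where
  "D_min F \<mu> = (INF G \<in> {G \<in> unit_distributions. (\<integral>x. x \<partial>G) \<ge> \<mu>}. KL F G)"

text \<open>A moment vector of length \<open>d\<close> is a function on \<open>nat\<close> of which only the values at
  \<open>1, \<dots>, d\<close> are used.\<close>

definition moment_class :: "nat \<Rightarrow> (nat \<Rightarrow> real) \<Rightarrow> real measure set" where
  "moment_class d M = {F \<in> unit_distributions. \<forall>k\<in>{1..d}. (\<integral>x. x ^ k \<partial>F) = M k}"

definition D_min_moments :: "nat \<Rightarrow> (nat \<Rightarrow> real) \<Rightarrow> real \<Rightarrow> ereal" where
  "D_min_moments d M \<mu> = (INF F \<in> moment_class d M. D_min F \<mu>)"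

text \<open>Logarithm with \<open>log 0 = -\<infinity>\<close>; together with \<open>0 * -\<infinity> = 0\<close> in \<open>ereal\<close>, terms with
  coefficient zero contribute zero. The value at negative arguments is irrelevant.\<close>

definition elog :: "real \<Rightarrow> ereal" where
  "elog x = (if x \<le> 0 then -\<infinity> else ereal (ln x))"

end

theory Submission
  imports Defs
begin

text \<open>For \<open>0 \<le> n < 1 / (1 - \<mu>)\<close> Gibbs' inequality bounds \<open>KL F G\<close>, for any \<open>G\<close> of mean at least
  \<open>\<mu>\<close>, from below by the \<open>F\<close>-expectation of \<open>ln (1 - (X - \<mu>) * n)\<close>. All derivatives of this integrand are
  negative, so by the remainder formula the Hermite interpolation polynomial at the atoms of the lower principal
  representation of the moment vector (\<open>1\<close> simple, an interior atom double, \<open>0\<close> simple for an odd number of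
  moments) lies below it. Hence the principal representation minimises the expectation for all \<open>n\<close>
  at once. At the optimal \<open>n = \<nu>\<close> the bound is attained by the \<open>G\<close> with density
  \<open>1 / (1 - (x - \<mu>) * \<nu>)\<close> with respect to the principal representation, with the missing mass, if any,
  placed at \<open>1\<close>.\<close>

section \<open>Hermite interpolation\<close>

lemma Rolle_finite:
  fixes f f' :: "real \<Rightarrow> real"
  assumes "finite S" "S \<noteq> {}" "S \<subseteq> {a..b}"
    and deriv: "\<And>x. x \<in> {a..b} \<Longrightarrow> (f has_real_derivative f' x) (at x)"
    and "\<And>x. x \<in> S \<Longrightarrow> f x = 0"
  obtains T where "finite T" "T \<subseteq> {a..b}" "T \<inter> S = {}" "Suc (card T) = card S"
    "\<And>x. x \<in> T \<Longrightarrow> f' x = 0"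
proof -
  have "\<exists>T. finite T \<and> T \<subseteq> {a..b} \<and> T \<inter> S = {} \<and> Suc (card T) = card S \<and>
          (\<forall>x\<in>T. f' x = 0) \<and> (\<forall>t\<in>T. \<exists>s\<in>S. t < s)"
    using assms(1,2,3,5)
  proof (induction S rule: finite_linorder_max_induct)
    case (insert m A)
    show ?case
    proof (cases "A = {}")
      case True
      then show ?thesis by (intro exI[of _ "{}"]) auto
    next
      case False
      then obtain T where T: "finite T" "T \<subseteq> {a..b}" "T \<inter> A = {}" "Suc (card T) = card A"
        "\<forall>x\<in>T. f' x = 0" "\<forall>t\<in>T. \<exists>s\<in>A. t < s"
        using insert.IH insert.prems by auto
      define l where "l = Max A"
      have l: "l \<in> A" "\<And>s. s \<in> A \<Longrightarrow> s \<le> l"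
        using False insert.hyps(1) by (auto simp: l_def)
      have lm: "l < m" using l insert.hyps by auto
      have sub: "x \<in> {a..b}" if "x \<in> {l..m}" for x
        using that l(1) insert.prems(2) by fastforce
      have "continuous_on {l..m} f"
        using deriv[OF sub] by (meson DERIV_isCont continuous_at_imp_continuous_on)
      moreover have "f l = f m"
        using l(1) insert.prems(3) by auto
      ultimately obtain z where z: "l < z" "z < m" "f' z = 0"
        using Rolle_deriv[OF lm, of f "\<lambda>x h. h * f' x"] deriv sub
        by (metis (no_types, lifting) atLeastAtMost_iff has_field_derivative_def less_imp_le
            mult.commute mult_1 ext)
      have zA: "z \<notin> A" and zT: "z \<notin> T" using z(1) l(2) T(6) by fastforce+
      show ?thesis
      proof (intro exI[of _ "insert z T"] conjI)
        show "insert z T \<subseteq> {a..b}" using T(2) sub z by auto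
        show "insert z T \<inter> insert m A = {}"
          using zA z(2) T(3,6) insert.hyps(2) by fastforce
        show "Suc (card (insert z T)) = card (insert m A)"
          using zT T(1,4) insert.hyps by (subst (2) card_insert_disjoint) auto
        show "\<forall>t\<in>insert z T. \<exists>s\<in>insert m A. t < s"
          using z T(6) by auto
      qed (use T z in auto)
    qed
  qed simp
  then show thesis using that by blast
qed

lemma Rolle_iterated:
  fixes f :: "nat \<Rightarrow> real \<Rightarrow> real"
  assumes "\<And>k x. x \<in> {a..b} \<Longrightarrow> (f k has_real_derivative f (Suc k) x) (at x)"
    and "finite S" "S \<subseteq> {a..b}" "card S = Suc n" "\<And>x. x \<in> S \<Longrightarrow> f k x = 0"
  shows "\<exists>\<xi>\<in>{a..b}. f (k + n) \<xi> = 0"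
  using assms(2-)
proof (induction n arbitrary: k S)
  case 0
  then obtain s where "S = {s}" by (auto simp: card_1_singleton_iff)
  then show ?case using 0 by auto
next
  case (Suc n)
  have "S \<noteq> {}" using Suc.prems by auto
  from Rolle_finite[OF Suc.prems(1) this Suc.prems(2) assms(1) Suc.prems(4)]
  obtain T where "finite T" "T \<subseteq> {a..b}" "Suc (card T) = card S" "\<And>x. x \<in> T \<Longrightarrow> f (Suc k) x = 0"
    by metis
  with Suc.IH[of T "Suc k"] Suc.prems(3) show ?case by simp
qed

definition nodal_poly :: "real set \<Rightarrow> real set \<Rightarrow> real poly" where
  "nodal_poly S D = (\<Prod>s\<in>S. [:- s, 1:]) * (\<Prod>s\<in>D. [:- s, 1:])"

lemma degree_nodal_poly: "finite S \<Longrightarrow> finite D \<Longrightarrow> degree (nodal_poly S D) = card S + card D"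
  and lead_coeff_nodal_poly: "lead_coeff (nodal_poly S D) = 1"
  unfolding nodal_poly_def
   apply (subst degree_mult_eq)
     apply (auto simp: degree_prod_eq_sum_degree)[3]
  by (simp add: lead_coeff_mult lead_coeff_prod)

lemma poly_nodal_poly: "poly (nodal_poly S D) x = (\<Prod>s\<in>S. x - s) * (\<Prod>s\<in>D. x - s)"
  by (simp add: nodal_poly_def poly_prod)

lemma poly_nodal_poly_eq_0_iff:
  "finite S \<Longrightarrow> finite D \<Longrightarrow> poly (nodal_poly S D) x = 0 \<longleftrightarrow> x \<in> S \<union> D"
  by (auto simp: poly_nodal_poly)

lemma nodal_poly_remove:
  "finite S \<Longrightarrow> s \<in> S \<Longrightarrow> nodal_poly S D = [:- s, 1:] * nodal_poly (S - {s}) D"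
  by (simp only: nodal_poly_def prod.remove[of S s] mult.assoc)

lemma poly_pderiv_nodal_poly:
  assumes "finite S" "s \<in> S"
  shows "poly (pderiv (nodal_poly S D)) s = poly (nodal_poly (S - {s}) D) s"
  by (simp only: nodal_poly_remove[OF assms] pderiv_mult poly_add poly_mult)
    (simp add: pderiv_pCons)

lemma Hermite_interpolation_exists:
  fixes u v :: "real \<Rightarrow> real"
  assumes "finite S" "D \<subseteq> S" "S \<noteq> {}"
  obtains P where "degree P < card S + card D" "\<And>x. x \<in> S \<Longrightarrow> poly P x = u x"
    "\<And>x. x \<in> D \<Longrightarrow> poly (pderiv P) x = v x"
proof -
  have Lagrange: "\<exists>P. degree P < card S \<and> (\<forall>x\<in>S. poly P x = u x)"
    using assms(1,3)
  proof (induction S rule: finite_ne_induct)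
    case (singleton x)
    then show ?case by (intro exI[of _ "[:u x:]"]) auto
  next
    case (insert s S)
    then obtain P where P: "degree P < card S" "\<forall>x\<in>S. poly P x = u x" by auto
    have nz: "poly (nodal_poly S {}) s \<noteq> 0"
      using insert by (subst poly_nodal_poly_eq_0_iff) auto
    define Q where "Q = P + smult ((u s - poly P s) / poly (nodal_poly S {}) s) (nodal_poly S {})"
    have "degree Q < card (insert s S)"
      using P insert unfolding Q_def
      by (intro le_less_trans[OF degree_add_le_max]) (auto simp: degree_nodal_poly)
    moreover have "poly Q x = u x" if "x \<in> insert s S" for x
      using that P nz insert poly_nodal_poly_eq_0_iff[of S "{}" x] by (auto simp: Q_def)
    ultimately show ?case by blast
  qed
  have "finite D" using assms finite_subset by blast
  then have "\<exists>P. degree P < card S + card D \<and> (\<forall>x\<in>S. poly P x = u x) \<and>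
          (\<forall>x\<in>D. poly (pderiv P) x = v x)"
    using \<open>D \<subseteq> S\<close>
  proof (induction D rule: finite_induct)
    case empty
    then show ?case using Lagrange by auto
  next
    case (insert s D)
    then obtain P where P: "degree P < card S + card D" "\<forall>x\<in>S. poly P x = u x"
      "\<forall>x\<in>D. poly (pderiv P) x = v x" by auto
    let ?W = "nodal_poly S D"
    have W': "poly (pderiv ?W) x = poly (nodal_poly (S - {x}) D) x" if "x \<in> S" for x
      by (rule poly_pderiv_nodal_poly[OF \<open>finite S\<close> that])
    have nz: "poly (pderiv ?W) s \<noteq> 0"
      using insert assms by (subst W') (auto simp: poly_nodal_poly_eq_0_iff)
    define Q where "Q = P + smult ((v s - poly (pderiv P) s) / poly (pderiv ?W) s) ?W"
    have "degree Q < card S + card (insert s D)"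
      using P insert assms unfolding Q_def
      by (intro le_less_trans[OF degree_add_le_max]) (auto simp: degree_nodal_poly)
    moreover have "poly Q x = u x" if "x \<in> S" for x
      using that P assms insert poly_nodal_poly_eq_0_iff[of S D x] by (auto simp: Q_def)
    moreover have "poly (pderiv Q) x = v x" if x: "x \<in> insert s D" for x
    proof (cases "x = s")
      case True
      then show ?thesis using nz by (simp add: Q_def pderiv_add pderiv_smult)
    next
      case False
      then have "x \<in> D" "x \<in> S" using x insert.prems by auto
      then have "poly (pderiv ?W) x = 0"
        using insert assms by (auto simp: W' poly_nodal_poly_eq_0_iff)
      then show ?thesis using P \<open>x \<in> D\<close> by (simp add: Q_def pderiv_add pderiv_smult)
    qed
    ultimately show ?case by blast
  qed
  then show thesis using that by blast
qed

lemma higher_pderiv_lead_coeff: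
  fixes P :: "real poly"
  assumes "degree P \<le> n"
  shows "poly ((pderiv ^^ n) P) x = fact n * coeff P n"
proof -
  have "degree ((pderiv ^^ n) P) = 0" using assms by (simp add: degree_higher_pderiv)
  then obtain c where c: "(pderiv ^^ n) P = [:c:]" by (rule degree_eq_zeroE)
  then have "c = coeff ((pderiv ^^ n) P) 0" by simp
  also have "\<dots> = fact n * coeff P n"
    by (simp add: coeff_higher_pderiv pochhammer_fact)
  finally show ?thesis using c by simp
qed

lemma Hermite_interpolation_remainder:
  fixes f :: "nat \<Rightarrow> real \<Rightarrow> real"
  assumes deriv: "\<And>k x. x \<in> {a..b} \<Longrightarrow> (f k has_real_derivative f (Suc k) x) (at x)"
    and S: "finite S" "S \<subseteq> {a..b}" and D: "D \<subseteq> S"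
    and n: "card S + card D = n"
    and P: "degree P < n" "\<And>x. x \<in> S \<Longrightarrow> poly P x = f 0 x"
      "\<And>x. x \<in> D \<Longrightarrow> poly (pderiv P) x = f 1 x"
    and x: "x \<in> {a..b}"
  shows "\<exists>\<xi>\<in>{a..b}. f 0 x - poly P x = f n \<xi> / fact n * poly (nodal_poly S D) x"
proof (cases "x \<in> S")
  case True
  have "finite D" using S D finite_subset by blast
  then have "poly (nodal_poly S D) x = 0" using True S by (simp add: poly_nodal_poly_eq_0_iff)
  then show ?thesis using True P(2) x by auto
next
  case False
  let ?W = "nodal_poly S D"
  have fD: "finite D" using S D finite_subset by blast
  have nz: "poly ?W x \<noteq> 0" using False S D fD by (auto simp: poly_nodal_poly_eq_0_iff)
  define K where "K = (f 0 x - poly P x) / poly ?W x"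
  define Q where "Q = P + smult K ?W"
  define \<phi> where "\<phi> = (\<lambda>k y. f k y - poly ((pderiv ^^ k) Q) y)"
  have d\<phi>: "(\<phi> k has_real_derivative \<phi> (Suc k) y) (at y)" if "y \<in> {a..b}" for k y
    unfolding \<phi>_def by (auto intro!: derivative_eq_intros deriv that)
  have z0: "\<phi> 0 y = 0" if "y \<in> insert x S" for y
    using that nz P(2) S fD poly_nodal_poly_eq_0_iff[of S D y] by (auto simp: \<phi>_def Q_def K_def)
  have z1: "\<phi> 1 y = 0" if "y \<in> D" for y
  proof -
    have "poly (pderiv ?W) y = 0"
      using that D S fD by (subst poly_pderiv_nodal_poly) (auto simp: poly_nodal_poly_eq_0_iff)
    then show ?thesis using that P(3) by (simp add: \<phi>_def Q_def pderiv_add pderiv_smult)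
  qed
  have "\<exists>\<xi>\<in>{a..b}. \<phi> n \<xi> = 0"
  proof -
    from Rolle_finite[of "insert x S" a b "\<phi> 0" "\<phi> 1"] d\<phi>[of _ 0] z0 S x
    obtain T where T: "finite T" "T \<subseteq> {a..b}" "T \<inter> insert x S = {}"
      "Suc (card T) = card (insert x S)" "\<And>y. y \<in> T \<Longrightarrow> \<phi> 1 y = 0"
      by (auto simp: Suc_leI)
    have TD: "T \<inter> D = {}" using T(3) D by auto
    have "card (T \<union> D) = n"
      using T(1,4) fD False S n by (simp add: card_Un_disjoint[OF T(1) fD TD])
    moreover have "0 < n" using P(1) by auto
    ultimately have "card (T \<union> D) = Suc (n - 1)" by simp
    moreover have "\<phi> 1 y = 0" if "y \<in> T \<union> D" for y using that T(5) z1 by auto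
    moreover have "finite (T \<union> D)" "T \<union> D \<subseteq> {a..b}" using T fD D S by auto
    ultimately have "\<exists>\<xi>\<in>{a..b}. \<phi> (1 + (n - 1)) \<xi> = 0"
      by (intro Rolle_iterated[of a b \<phi> "T \<union> D"] d\<phi>)
    then show ?thesis using \<open>0 < n\<close> by simp
  qed
  then obtain \<xi> where \<xi>: "\<xi> \<in> {a..b}" "\<phi> n \<xi> = 0" by auto
  have dW: "degree ?W = n" using n S fD by (simp add: degree_nodal_poly)
  then have cW: "coeff ?W n = 1" using lead_coeff_nodal_poly by metis
  have "degree Q \<le> n"
    using P(1) dW unfolding Q_def by (intro degree_add_le) auto
  then have "poly ((pderiv ^^ n) Q) \<xi> = fact n * K"
    using P(1) cW by (simp add: higher_pderiv_lead_coeff Q_def coeff_eq_0)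
  then have "K = f n \<xi> / fact n" using \<xi>(2) by (simp add: \<phi>_def)
  moreover have "f 0 x - poly P x = K * poly ?W x" using nz by (simp add: K_def)
  ultimately show ?thesis using \<xi>(1) by auto
qed

lemma has_real_derivative_ln_affine_iterated:
  fixes n \<mu> :: real
  defines "f \<equiv> \<lambda>k x. if k = 0 then ln (1 - (x - \<mu>) * n)
                   else - (fact (k - 1) * n ^ k / (1 - (x - \<mu>) * n) ^ k)"
  assumes "0 < 1 - (x - \<mu>) * n"
  shows "(f k has_real_derivative f (Suc k) x) (at x)"
proof (cases k)
  case 0
  then show ?thesis using assms(2)
    by (auto simp: f_def intro!: derivative_eq_intros)
next
  case (Suc j)
  define h where "h = 1 - (x - \<mu>) * n"
  have h: "h > 0" using assms(2) by (simp add: h_def)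
  have "((\<lambda>x. inverse (1 - (x - \<mu>) * n)) has_real_derivative n * inverse h ^ 2) (at x)"
    using h unfolding h_def by (auto intro!: derivative_eq_intros simp: power2_eq_square)
  from DERIV_power[OF this, of k]
  have "((\<lambda>x. - (fact j * n ^ k) * inverse (1 - (x - \<mu>) * n) ^ k) has_real_derivative
          - (fact (Suc j) * n ^ Suc k) * inverse h ^ Suc k) (at x)"
    by (rule DERIV_cong[OF DERIV_cmult])
      (simp only: h_def[symmetric], simp add: Suc power2_eq_square algebra_simps)
  then show ?thesis using Suc by (simp add: f_def h_def divide_inverse power_inverse)
qed

lemma ln_affine_poly_minorant:
  fixes n \<mu> :: real
  assumes n: "0 < n" and pos: "\<And>x. x \<in> {0..1} \<Longrightarrow> 0 < 1 - (x - \<mu>) * n"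
    and S: "finite S" "S \<subseteq> {0..1}" "D \<subseteq> S" "S \<noteq> {}"
    and nodal: "\<And>x. x \<in> {0..1} \<Longrightarrow> poly (nodal_poly S D) x \<le> 0"
  obtains P where "degree P < card S + card D"
    "\<And>x. x \<in> S \<Longrightarrow> poly P x = ln (1 - (x - \<mu>) * n)"
    "\<And>x. x \<in> {0..1} \<Longrightarrow> poly P x \<le> ln (1 - (x - \<mu>) * n)"
proof -
  define f where "f = (\<lambda>k x. if k = 0 then ln (1 - (x - \<mu>) * n)
                   else - (fact (k - 1) * n ^ k / (1 - (x - \<mu>) * n) ^ k))"
  have f: "(f k has_real_derivative f (Suc k) x) (at x)" if "x \<in> {0..1}" for k x
    unfolding f_def by (rule has_real_derivative_ln_affine_iterated) (rule pos[OF that])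
  define N where "N = card S + card D"
  obtain P where P: "degree P < N" "\<And>x. x \<in> S \<Longrightarrow> poly P x = f 0 x"
    "\<And>x. x \<in> D \<Longrightarrow> poly (pderiv P) x = f 1 x"
    using Hermite_interpolation_exists[OF S(1,3,4), of "f 0" "f 1"] unfolding N_def by blast
  have "poly P x \<le> f 0 x" if x: "x \<in> {0..1}" for x
  proof -
    obtain \<xi> where \<xi>: "\<xi> \<in> {0..1}" "f 0 x - poly P x = f N \<xi> / fact N * poly (nodal_poly S D) x"
      using Hermite_interpolation_remainder[OF f S(1,2,3) N_def[symmetric] P x] by blast
    have "f N \<xi> / fact N \<le> 0"
      using P(1) pos[OF \<xi>(1)] n by (auto simp: f_def)
    with nodal[OF x] have "0 \<le> f N \<xi> / fact N * poly (nodal_poly S D) x"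
      by (rule mult_nonpos_nonpos[rotated])
    then show ?thesis using \<xi>(2) by linarith
  qed
  then show thesis using P that[of P] by (simp add: N_def f_def)
qed

section \<open>Distributions on the unit interval\<close>

lemma unit_distributionsD:
  assumes "F \<in> unit_distributions"
  shows "prob_space F" "sets F = sets borel" "space F = UNIV" "AE x in F. x \<in> {0..1}"
proof -
  from assms interpret real_distribution F by (simp add: unit_distributions_def)
  show "prob_space F" "sets F = sets borel" "space F = UNIV" by unfold_locales auto
  have "prob {0..1} = 1" using assms by (simp add: unit_distributions_def)
  then show "AE x in F. x \<in> {0..1}" by (subst (asm) prob_eq_1) auto
qed

lemma unit_distributionsI:
  assumes "prob_space F" "sets F = sets borel" "AE x in F. x \<in> {0..1}"
  shows "F \<in> unit_distributions"
proof -
  interpret prob_space F by fact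
  have "real_distribution F" using assms sets_eq_imp_space_eq[OF assms(2)]
    by (simp add: real_distribution_def real_distribution_axioms_def)
  moreover have "prob {0..1} = 1" using assms by (subst prob_eq_1) auto
  ultimately show ?thesis by (simp add: unit_distributions_def)
qed

lemma integrable_unit_distribution:
  fixes u :: "real \<Rightarrow> real"
  assumes F: "F \<in> unit_distributions" and [measurable]: "u \<in> borel_measurable borel"
    and "\<And>x. x \<in> {0..1} \<Longrightarrow> \<bar>u x\<bar> \<le> B"
  shows "integrable F u"
proof -
  note F' = unit_distributionsD[OF F]
  interpret prob_space F by (rule F')
  have "AE x in F. norm (u x) \<le> B" using F'(4) by eventually_elim (use assms(3) in simp)
  moreover have "u \<in> borel_measurable F"
    using F'(2) by (simp cong: measurable_cong_sets)
  ultimately show ?thesis by (intro integrable_const_bound)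
qed

lemma integrable_poly_unit_distribution:
  assumes "F \<in> unit_distributions"
  shows "integrable F (poly P)"
proof -
  have "continuous_on {0..1::real} (poly P)" by (intro continuous_intros)
  then have "bounded (poly P ` {0..1::real})"
    by (intro compact_imp_bounded compact_continuous_image) auto
  then obtain B where "\<forall>x\<in>{0..1}. \<bar>poly P x\<bar> \<le> B"
    by (auto simp: bounded_iff)
  moreover have "poly P \<in> borel_measurable borel"
    by (intro borel_measurable_continuous_onI continuous_intros)
  ultimately show ?thesis by (intro integrable_unit_distribution[OF assms]) auto
qed

lemma integral_poly_moments:
  assumes "F \<in> moment_class d M" "degree P \<le> d"
  shows "(\<integral>x. poly P x \<partial>F) = coeff P 0 + (\<Sum>k=1..d. coeff P k * M k)"
proof -
  have F: "F \<in> unit_distributions" and m: "\<And>k. k \<in> {1..d} \<Longrightarrow> (\<integral>x. x ^ k \<partial>F) = M k"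
    using assms(1) by (auto simp: moment_class_def)
  interpret prob_space F by (rule unit_distributionsD[OF F])
  have int: "integrable F (\<lambda>x. x ^ k)" for k
    using integrable_poly_unit_distribution[OF F, of "monom 1 k"]
    by (simp add: poly_monom[abs_def])
  have "poly P x = (\<Sum>k\<le>d. coeff P k * x ^ k)" for x
    using arg_cong[OF poly_as_sum_of_monoms'[OF assms(2)], of "\<lambda>Q. poly Q x"]
    by (simp add: poly_sum poly_monom)
  then have "(\<integral>x. poly P x \<partial>F) = (\<Sum>k\<le>d. coeff P k * (\<integral>x. x ^ k \<partial>F))"
    by (simp add: Bochner_Integration.integral_sum int)
  also have "\<dots> = coeff P 0 + (\<Sum>k=1..d. coeff P k * (\<integral>x. x ^ k \<partial>F))"
    by (simp add: atMost_atLeast0 sum.atLeast_Suc_atMost prob_space)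
  also have "\<dots> = coeff P 0 + (\<Sum>k=1..d. coeff P k * M k)"
    using m by simp
  finally show ?thesis .
qed

lemma integral_poly_nonneg:
  assumes "F \<in> unit_distributions" "\<And>x. x \<in> {0..1} \<Longrightarrow> 0 \<le> poly P x"
  shows "0 \<le> (\<integral>x. poly P x \<partial>F)"
proof (rule integral_nonneg_AE)
  show "AE x in F. 0 \<le> poly P x"
    using unit_distributionsD(4)[OF assms(1)] by eventually_elim (rule assms(2))
qed

lemma moments_poly_nonneg:
  assumes "F \<in> moment_class d M" "degree P \<le> d" "\<And>x. x \<in> {0..1} \<Longrightarrow> 0 \<le> poly P x"
  shows "0 \<le> coeff P 0 + (\<Sum>k=1..d. coeff P k * M k)"
  using integral_poly_nonneg[of F P] integral_poly_moments[OF assms(1,2)] assms(1,3)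
  by (simp add: moment_class_def)

lemma integrable_ln_affine:
  assumes F: "F \<in> unit_distributions"
    and pos: "\<And>x. x \<in> {0..1} \<Longrightarrow> 0 < 1 - (x - \<mu>) * n"
  shows "integrable F (\<lambda>x. ln (1 - (x - \<mu>) * n))"
proof -
  have "continuous_on {0..1} (\<lambda>x. ln (1 - (x - \<mu>) * n))"
    by (intro continuous_intros ballI) (use pos in fastforce)
  then have "bounded ((\<lambda>x. ln (1 - (x - \<mu>) * n)) ` {0..1})"
    by (intro compact_imp_bounded compact_continuous_image) auto
  then obtain B where "\<forall>x\<in>{0..1}. \<bar>ln (1 - (x - \<mu>) * n)\<bar> \<le> B"
    by (auto simp: bounded_iff)
  then show ?thesis by (intro integrable_unit_distribution[OF F]) auto
qed

lemma KL_ge_expectation_ln: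
  assumes F: "F \<in> unit_distributions" and G: "G \<in> unit_distributions"
    and \<mu>: "(\<integral>x. x \<partial>G) \<ge> \<mu>" and n: "0 \<le> n"
    and pos: "\<And>x. x \<in> {0..1} \<Longrightarrow> 0 < 1 - (x - \<mu>) * n"
  shows "ereal (\<integral>x. ln (1 - (x - \<mu>) * n) \<partial>F) \<le> KL F G"
proof (cases "(\<exists>f\<in>borel_measurable G. density G f = F) \<and> integrable F (entropy_density (exp 1) G F)")
  case True
  then obtain f where f: "f \<in> borel_measurable G" "density G f = F"
    and int: "integrable F (entropy_density (exp 1) G F)" by blast
  note F' = unit_distributionsD[OF F] and G' = unit_distributionsD[OF G]
  interpret F: prob_space F by (rule F')
  interpret G: prob_space G by (rule G')
  define h where "h = (\<lambda>x::real. 1 - (x - \<mu>) * n)"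
  have [measurable]: "h \<in> borel_measurable borel" by (simp add: h_def)
  have hF [measurable]: "h \<in> borel_measurable F" and hG [measurable]: "h \<in> borel_measurable G"
    using F'(2) G'(2) by (simp_all cong: measurable_cong_sets)
  have "absolutely_continuous G F"
    using f absolutely_continuousI_density by blast
  moreover have sets_eq: "sets F = sets G" using F' G' by simp
  ultimately obtain r where r [measurable]: "r \<in> borel_measurable G"
    and rG: "AE x in G. RN_deriv G F x = ennreal (r x)"
    and rF: "AE x in F. 0 < r x" and r0: "\<And>x. 0 \<le> r x"
    by (rule G.real_RN_deriv[OF F.finite_measure_axioms]) blast
  have rmF [measurable]: "r \<in> borel_measurable F"
    using r sets_eq by (simp cong: measurable_cong_sets)
  have "F = density G (RN_deriv G F)" using RN_derivI[OF f] by simp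
  also have "\<dots> = density G (\<lambda>x. ennreal (r x))"
    using rG by (intro density_cong) auto
  finally have Fr: "F = density G (\<lambda>x. ennreal (r x))" .
  have "AE x in F. RN_deriv G F x = ennreal (r x)"
    using rG r by (subst Fr) (auto simp: AE_density elim!: eventually_mono)
  then have ent: "AE x in F. entropy_density (exp 1) G F x = ln (r x)"
    by eventually_elim (simp add: entropy_density_def log_def r0)
  have hpos: "AE x in F. 0 < h x" "AE x in G. 0 < h x"
    using F'(4) by (eventually_elim, simp only: h_def pos)
      (use G'(4) in \<open>eventually_elim, simp only: h_def pos\<close>)
  have hint: "integrable G h" and Gh: "(\<integral>x. h x \<partial>G) \<le> 1"
  proof -
    have id: "integrable G (\<lambda>x. x)"
      by (rule integrable_unit_distribution[OF G, where B = 1]) auto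
    then show "integrable G h" by (simp add: h_def)
    have "(\<integral>x. h x \<partial>G) = 1 - ((\<integral>x. x \<partial>G) - \<mu>) * n"
      using id by (simp add: h_def G.prob_space)
    then show "(\<integral>x. h x \<partial>G) \<le> 1" using \<mu> n by simp
  qed
  have quot_nn: "(\<integral>\<^sup>+x. ennreal (h x / r x) \<partial>F) \<le> ennreal 1"
  proof -
    have "(\<integral>\<^sup>+x. ennreal (h x / r x) \<partial>F) = (\<integral>\<^sup>+x. ennreal (r x) * ennreal (h x / r x) \<partial>G)"
      by (subst Fr) (simp add: nn_integral_density)
    also have "\<dots> \<le> (\<integral>\<^sup>+x. ennreal (h x) \<partial>G)"
      using hpos(2)
    proof (intro nn_integral_mono_AE, eventually_elim)
      case (elim x)
      then show ?case using r0[of x]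
        by (cases "r x = 0") (auto simp: ennreal_mult'[symmetric])
    qed
    also have "\<dots> = ennreal (\<integral>x. h x \<partial>G)"
      using hpos(2) by (intro nn_integral_eq_integral hint) (auto elim: eventually_mono)
    also have "\<dots> \<le> ennreal 1" using Gh by (rule ennreal_leI)
    finally show ?thesis .
  qed
  have quot0: "AE x in F. 0 \<le> h x / r x" using hpos(1) rF by eventually_elim simp
  have quot_int: "integrable F (\<lambda>x. h x / r x)"
    using quot_nn quot0 by (intro integrableI_nonneg) (auto simp: le_less_trans)
  have quot: "(\<integral>x. h x / r x \<partial>F) \<le> 1"
    using quot_nn quot0 by (subst integral_eq_nn_integral) (auto simp: enn2real_leI)
  have lnr: "integrable F (\<lambda>x. ln (r x))"
    using ent borel_measurable_integrable[OF int] int by (subst (asm) integrable_cong_AE) auto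
  have lnh: "integrable F (\<lambda>x. ln (h x))"
    unfolding h_def by (rule integrable_ln_affine[OF F pos])
  have "(\<integral>x. ln (h x) \<partial>F) - (\<integral>x. ln (r x) \<partial>F) = (\<integral>x. ln (h x) - ln (r x) \<partial>F)"
    using lnh lnr by simp
  also have "\<dots> \<le> (\<integral>x. h x / r x - 1 \<partial>F)"
    using hpos(1) rF
  proof (intro integral_mono_AE, goal_cases)
    case 3
    then show ?case
    proof eventually_elim
      case (elim x)
      then show ?case using ln_le_minus_one[of "h x / r x"] by (simp add: ln_div)
    qed
  qed (use lnh lnr quot_int in auto)
  also have "\<dots> \<le> 0" using quot quot_int by (simp add: F.prob_space)
  finally have "(\<integral>x. ln (h x) \<partial>F) \<le> (\<integral>x. ln (r x) \<partial>F)" by simp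
  also have "\<dots> = KL_divergence (exp 1) G F"
    unfolding KL_divergence_def using ent borel_measurable_integrable[OF int]
    by (intro integral_cong_AE) auto
  finally show ?thesis using True by (simp add: KL_def h_def)
qed (auto simp: KL_def)

section \<open>The saddle point\<close>

definition discrete_measure :: "real set \<Rightarrow> (real \<Rightarrow> real) \<Rightarrow> real measure" where
  "discrete_measure S g = distr (point_measure S (\<lambda>x. ennreal (g x))) borel (\<lambda>x. x)"

lemma sets_discrete_measure [simp, measurable_cong]: "sets (discrete_measure S g) = sets borel"
  and space_discrete_measure [simp]: "space (discrete_measure S g) = UNIV"
  by (simp_all add: discrete_measure_def)

context
  fixes S :: "real set" and g :: "real \<Rightarrow> real"
  assumes S: "finite S" and g: "\<And>x. x \<in> S \<Longrightarrow> 0 \<le> g x"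
begin

lemma integrable_discrete_measure:
  fixes u :: "real \<Rightarrow> real"
  assumes "u \<in> borel_measurable borel"
  shows "integrable (discrete_measure S g) u"
  unfolding discrete_measure_def using assms S g
  by (subst integrable_distr_eq) (auto intro!: integrable_point_measure_finite)

lemma integral_discrete_measure:
  fixes u :: "real \<Rightarrow> real"
  assumes "u \<in> borel_measurable borel"
  shows "(\<integral>x. u x \<partial>discrete_measure S g) = (\<Sum>x\<in>S. g x * u x)"
  unfolding discrete_measure_def using assms S g
  by (subst integral_distr) (auto simp: lebesgue_integral_point_measure_finite)

lemma AE_discrete_measure: "AE x in discrete_measure S g. x \<in> S"
  unfolding discrete_measure_def using S
  by (subst AE_distr_iff) (auto simp: AE_point_measure intro: finite_imp_closed borel_closed)

lemma prob_space_discrete_measure: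
  assumes "(\<Sum>x\<in>S. g x) = 1"
  shows "prob_space (discrete_measure S g)"
  unfolding discrete_measure_def using assms S g
  by (intro prob_space.prob_space_distr prob_space_point_measure) auto

end

lemma D_min_moments_saddle:
  fixes f g :: "real \<Rightarrow> real"
  assumes S: "finite S" "S \<subseteq> {0..1}" "S \<noteq> {}" "D \<subseteq> S" and card: "card S + card D \<le> Suc d"
    and nodal: "\<And>x. x \<in> {0..1} \<Longrightarrow> poly (nodal_poly S D) x \<le> 0"
    and g: "\<And>x. x \<in> S \<Longrightarrow> 0 \<le> g x" "(\<Sum>x\<in>S. g x) = 1"
    and \<nu>: "0 < \<nu>" "(1 - \<mu>) * \<nu> \<le> 1" and \<mu>: "\<mu> < 1"
    and f: "\<And>x. x \<in> S \<Longrightarrow> f x = g x * (1 - (x - \<mu>) * \<nu>)" "(\<Sum>x\<in>S. f x) = 1"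
    and moments: "\<And>k. k \<in> {1..d} \<Longrightarrow> (\<Sum>x\<in>S. f x * x ^ k) = M k"
  shows "D_min_moments d M \<mu> = ereal (\<Sum>x\<in>S. f x * ln (1 - (x - \<mu>) * \<nu>))"
proof (rule antisym)
  define G where "G = discrete_measure S g"
  define h where "h = (\<lambda>x::real. max 0 (1 - (x - \<mu>) * \<nu>))"
  define F where "F = density G (\<lambda>x. ennreal (h x))"
  have h_eq: "h x = 1 - (x - \<mu>) * \<nu>" if "x \<in> S" for x
  proof -
    have "(x - \<mu>) * \<nu> \<le> (1 - \<mu>) * \<nu>" using that S \<nu> by (intro mult_right_mono) auto
    then have "0 \<le> 1 - (x - \<mu>) * \<nu>" using \<nu> by linarith
    then show ?thesis by (simp only: h_def max.absorb2)
  qed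
  have hm [measurable]: "h \<in> borel_measurable borel" and h0: "\<And>x. 0 \<le> h x"
    by (simp_all add: h_def)
  have setsG [measurable_cong]: "sets G = sets borel" by (simp add: G_def)
  interpret G: prob_space G
    unfolding G_def by (intro prob_space_discrete_measure S g)
  have "AE x in G. x \<in> S" unfolding G_def by (intro AE_discrete_measure S g)
  then have "AE x in G. x \<in> {0..1}" by eventually_elim (use S(2) in blast)
  then have G: "G \<in> unit_distributions"
    using setsG by (intro unit_distributionsI G.prob_space_axioms)
  have intG: "(\<integral>x. u x \<partial>G) = (\<Sum>x\<in>S. g x * u x)" if "u \<in> borel_measurable borel" for u :: "real \<Rightarrow> real"
    unfolding G_def by (intro integral_discrete_measure S g that)
  have intF: "(\<integral>x. u x \<partial>F) = (\<Sum>x\<in>S. f x * u x)"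
    if [measurable]: "u \<in> borel_measurable borel" for u :: "real \<Rightarrow> real"
  proof -
    have "(\<integral>x. u x \<partial>F) = (\<integral>x. h x * u x \<partial>G)"
      unfolding F_def using h0 by (subst integral_density) auto
    also have "\<dots> = (\<Sum>x\<in>S. g x * (h x * u x))" by (intro intG) simp
    also have "\<dots> = (\<Sum>x\<in>S. f x * u x)" by (intro sum.cong) (auto simp: h_eq f)
    finally show ?thesis .
  qed
  have "prob_space F"
  proof -
    have "emeasure F (space F) = (\<integral>\<^sup>+x. ennreal (h x) \<partial>G)"
      unfolding F_def by (subst emeasure_density) (auto intro!: nn_integral_cong)
    also have "\<dots> = ennreal (\<integral>x. h x \<partial>G)"
      using h0 unfolding G_def
      by (intro nn_integral_eq_integral integrable_discrete_measure S g hm) auto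
    also have "(\<integral>x. h x \<partial>G) = (\<Sum>x\<in>S. f x)"
      by (subst intG) (auto simp: h_eq f intro!: sum.cong)
    finally show ?thesis using f(2) by (intro prob_spaceI) simp
  qed
  moreover have "AE x in F. x \<in> {0..1}"
  proof -
    have "AE x in G. 0 < ennreal (h x) \<longrightarrow> x \<in> {0..1}"
      using unit_distributionsD(4)[OF G] by eventually_elim simp
    moreover have "(\<lambda>x. ennreal (h x)) \<in> borel_measurable G" by measurable
    ultimately show ?thesis unfolding F_def by (simp only: AE_density)
  qed
  ultimately have "F \<in> unit_distributions"
    using setsG by (intro unit_distributionsI) (auto simp: F_def)
  then have F: "F \<in> moment_class d M"
    using moments by (auto simp: moment_class_def intF)
  have "(\<Sum>x\<in>S. f x) = (\<Sum>x\<in>S. g x) - \<nu> * ((\<Sum>x\<in>S. g x * x) - \<mu> * (\<Sum>x\<in>S. g x))"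
    by (simp add: f sum_distrib_left sum_subtractf[symmetric] algebra_simps)
  then have mean: "(\<integral>x. x \<partial>G) = \<mu>" using f(2) g(2) \<nu>(1) by (subst intG) auto
  have "AE x in G. ennreal (h x) = RN_deriv G F x"
    by (rule G.RN_deriv_unique) (auto simp: F_def)
  then have "AE x in G. RN_deriv G F x = ennreal (h x)" by eventually_elim simp
  then have ent: "AE x in F. entropy_density (exp 1) G F x = ln (h x)"
    unfolding F_def by (subst AE_density)
      (auto simp: entropy_density_def log_def h0 F_def[symmetric] elim!: eventually_mono)
  have "integrable F (\<lambda>x. ln (h x))"
    unfolding F_def using h0 by (subst integrable_density)
      (auto simp: G_def intro!: integrable_discrete_measure S g)
  then have "integrable F (entropy_density (exp 1) G F)"
    using ent by (subst integrable_cong_AE) (auto simp: F_def)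
  moreover have "density G (\<lambda>x. ennreal (h x)) = F" by (simp add: F_def)
  ultimately have "KL F G = ereal (KL_divergence (exp 1) G F)"
    unfolding KL_def by (subst if_P) (auto intro!: bexI[of _ "\<lambda>x. ennreal (h x)"])
  also have "KL_divergence (exp 1) G F = (\<integral>x. ln (h x) \<partial>F)"
    unfolding KL_divergence_def using ent by (intro integral_cong_AE) (auto simp: F_def)
  also have "\<dots> = (\<Sum>x\<in>S. f x * ln (1 - (x - \<mu>) * \<nu>))"
    by (subst intF) (auto simp: h_eq intro!: sum.cong)
  finally have KL: "KL F G = ereal (\<Sum>x\<in>S. f x * ln (1 - (x - \<mu>) * \<nu>))" .
  have "D_min_moments d M \<mu> \<le> D_min F \<mu>"
    unfolding D_min_moments_def by (rule INF_lower[OF F])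
  also have "\<dots> \<le> KL F G"
    unfolding D_min_def using G mean by (intro INF_lower) auto
  finally show "D_min_moments d M \<mu> \<le> ereal (\<Sum>x\<in>S. f x * ln (1 - (x - \<mu>) * \<nu>))"
    using KL by simp

  have lower: "ereal (\<Sum>x\<in>S. f x * ln (1 - (x - \<mu>) * n)) \<le> KL F' G'"
    if F': "F' \<in> moment_class d M" and G': "G' \<in> unit_distributions" "\<mu> \<le> (\<integral>x. x \<partial>G')"
      and n: "0 < n" "n < \<nu>" for F' G' n
  proof -
    have F'u: "F' \<in> unit_distributions" using F' by (simp add: moment_class_def)
    have pos: "0 < 1 - (x - \<mu>) * n" if "x \<in> {0..1}" for x
    proof -
      have "(x - \<mu>) * n \<le> (1 - \<mu>) * n" using that n by (intro mult_right_mono) auto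
      also have "\<dots> < (1 - \<mu>) * \<nu>" using n \<mu> by (intro mult_strict_left_mono) auto
      finally show ?thesis using \<nu> by simp
    qed
    from ln_affine_poly_minorant[OF n(1) pos S(1,2,4,3) nodal]
    obtain P where P: "degree P < card S + card D"
      "\<And>x. x \<in> S \<Longrightarrow> poly P x = ln (1 - (x - \<mu>) * n)"
      "\<And>x. x \<in> {0..1} \<Longrightarrow> poly P x \<le> ln (1 - (x - \<mu>) * n)" by blast
    have dP: "degree P \<le> d" using P(1) card by simp
    have "(\<Sum>x\<in>S. f x * ln (1 - (x - \<mu>) * n)) = (\<integral>x. poly P x \<partial>F)"
      using P(2) by (subst intF) (auto intro!: borel_measurable_continuous_onI continuous_intros)
    also have "\<dots> = (\<integral>x. poly P x \<partial>F')"
      using integral_poly_moments[OF F dP] integral_poly_moments[OF F' dP] by simp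
    also have "\<dots> \<le> (\<integral>x. ln (1 - (x - \<mu>) * n) \<partial>F')"
    proof (rule integral_mono_AE)
      show "integrable F' (poly P)" by (rule integrable_poly_unit_distribution[OF F'u])
      show "integrable F' (\<lambda>x. ln (1 - (x - \<mu>) * n))"
        by (rule integrable_ln_affine[OF F'u pos])
      show "AE x in F'. poly P x \<le> ln (1 - (x - \<mu>) * n)"
        using unit_distributionsD(4)[OF F'u] by eventually_elim (rule P(3))
    qed
    finally show ?thesis
      using KL_ge_expectation_ln[OF F'u G' less_imp_le[OF n(1)] pos] by (meson ereal_less_eq(3) order_trans)
  qed
  text \<open>If \<open>(1 - \<mu>) * \<nu> = 1\<close>, the argument of the logarithm vanishes at the node \<open>1\<close>, and the value at \<open>\<nu>\<close>
    is only a limit of lower bounds; the atom of \<open>f\<close> at \<open>1\<close> then has mass \<open>0\<close>.\<close>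

  have lim: "((\<lambda>n. ereal (\<Sum>x\<in>S. f x * ln (1 - (x - \<mu>) * n))) \<longlongrightarrow>
               ereal (\<Sum>x\<in>S. f x * ln (1 - (x - \<mu>) * \<nu>))) (at_left \<nu>)"
  proof (intro tendsto_ereal tendsto_sum)
    fix x assume x: "x \<in> S"
    show "((\<lambda>n. f x * ln (1 - (x - \<mu>) * n)) \<longlongrightarrow> f x * ln (1 - (x - \<mu>) * \<nu>)) (at_left \<nu>)"
    proof (cases "f x = 0")
      case False
      then have "1 - (x - \<mu>) * \<nu> \<noteq> 0" using f(1)[OF x] by auto
      then show ?thesis by (intro tendsto_intros)
    qed simp
  qed
  have ev: "\<forall>\<^sub>F n in at_left \<nu>. n \<in> {0<..<\<nu>}"
    using \<nu>(1) by (intro eventually_at_left_real)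
  show "ereal (\<Sum>x\<in>S. f x * ln (1 - (x - \<mu>) * \<nu>)) \<le> D_min_moments d M \<mu>"
    unfolding D_min_moments_def D_min_def
  proof (intro INF_greatest)
    fix F' G' assume "F' \<in> moment_class d M" "G' \<in> {G \<in> unit_distributions. \<mu> \<le> (\<integral>x. x \<partial>G)}"
    then have "\<forall>\<^sub>F n in at_left \<nu>. ereal (\<Sum>x\<in>S. f x * ln (1 - (x - \<mu>) * n)) \<le> KL F' G'"
      using ev by (auto elim!: eventually_mono intro!: lower)
    then show "ereal (\<Sum>x\<in>S. f x * ln (1 - (x - \<mu>) * \<nu>)) \<le> KL F' G'"
      by (intro tendsto_upperbound[OF lim]) auto
  qed
qed

lemma ereal_times_elog: "0 < y \<or> c = 0 \<Longrightarrow> ereal c * elog y = ereal (c * ln y)"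
  by (auto simp: elog_def zero_ereal_def[symmetric])

lemma D_min_moments_two_point:
  fixes p \<mu> :: real
  assumes p: "0 \<le> p" "p \<le> M 1" and \<mu>: "M 1 < \<mu>" "\<mu> < 1" and D: "D \<subseteq> {p}" "p = 0 \<or> D = {p}" and card: "card D < d"
    and moments: "\<And>k. k \<in> {1..d} \<Longrightarrow> (1 - M 1) / (1 - p) * p ^ k + (M 1 - p) / (1 - p) = M k"
  shows "D_min_moments d M \<mu> =
           ereal ((1 - M 1) / (1 - p)) * elog ((1 - M 1) / (1 - \<mu>)) +
           ereal ((M 1 - p) / (1 - p)) * elog ((M 1 - p) / (\<mu> - p))"
proof -
  define \<nu> where "\<nu> = (\<mu> - M 1) / ((\<mu> - p) * (1 - \<mu>))"
  define f where "f = (\<lambda>x. if x = p then (1 - M 1) / (1 - p) else (M 1 - p) / (1 - p))"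
  define g where "g = (\<lambda>x. if x = p then (1 - \<mu>) / (1 - p) else (\<mu> - p) / (1 - p))"
  have p1: "p < 1" "p < \<mu>" using p \<mu> by auto
  have e: "1 - (p - \<mu>) * \<nu> = (1 - M 1) / (1 - \<mu>)" "1 - (1 - \<mu>) * \<nu> = (M 1 - p) / (\<mu> - p)"
    using p1 \<mu> by (auto simp: \<nu>_def divide_simps) (simp add: algebra_simps)
  have "D_min_moments d M \<mu> = ereal (\<Sum>x\<in>{p, 1}. f x * ln (1 - (x - \<mu>) * \<nu>))"
  proof (rule D_min_moments_saddle[where g = g and D = D])
    show "card {p, 1} + card D \<le> Suc d" using p1 card by simp
    show "D \<subseteq> {p, 1}" using D(1) by auto
    show "poly (nodal_poly {p, 1} D) x \<le> 0" if "x \<in> {0..1}" for x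
    proof (cases "D = {p}")
      case True
      have "(x - p) * (x - p) * (x - 1) \<le> 0" using that by (intro mult_nonneg_nonpos) auto
      then show ?thesis using True p1 by (simp add: poly_nodal_poly mult_ac)
    next
      case False
      then have "D = {}" "p = 0" using D by auto
      then show ?thesis using that by (simp add: poly_nodal_poly mult_nonneg_nonpos)
    qed
    have "0 \<le> 1 - (1 - \<mu>) * \<nu>" unfolding e(2) using p p1 by simp
    then show "(1 - \<mu>) * \<nu> \<le> 1" by linarith
    show "0 < \<nu>" using p1 \<mu> by (simp add: \<nu>_def)
    show "0 \<le> g x" if "x \<in> {p, 1}" for x using p1 \<mu> by (simp add: g_def)
    show "f x = g x * (1 - (x - \<mu>) * \<nu>)" if "x \<in> {p, 1}" for x
      using that p1 \<mu> by (auto simp: f_def g_def e)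
    show "(\<Sum>x\<in>{p, 1}. g x) = 1" "(\<Sum>x\<in>{p, 1}. f x) = 1"
      using p1 by (auto simp: f_def g_def add_divide_distrib[symmetric])
    show "(\<Sum>x\<in>{p, 1}. f x * x ^ k) = M k" if "k \<in> {1..d}" for k
      using moments[OF that] p1 by (simp add: f_def)
  qed (use p p1 \<mu> in auto)
  also have "(\<Sum>x\<in>{p, 1}. f x * ln (1 - (x - \<mu>) * \<nu>)) =
      (1 - M 1) / (1 - p) * ln ((1 - M 1) / (1 - \<mu>)) + (M 1 - p) / (1 - p) * ln ((M 1 - p) / (\<mu> - p))"
    using p1 by (simp add: f_def e)
  finally show ?thesis
    using p p1 \<mu> by (subst (1 2) ereal_times_elog) auto
qed

lemma quadratic_root_bounds:
  fixes a b c z :: real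
  defines "\<nu> \<equiv> if a \<noteq> 0 then (- b + sqrt (b\<^sup>2 + 4 * a * c)) / (2 * a) else c / b"
  assumes c: "0 < c" and z: "0 < z" "0 \<le> a * z\<^sup>2 + b * z - c"
  shows "0 < \<nu>" "\<nu> \<le> z" "a * \<nu>\<^sup>2 + b * \<nu> = c" "0 \<le> 2 * a * \<nu> + b"
proof -
  define s where "s = sqrt (b\<^sup>2 + 4 * a * c)"
  have disc: "(2 * a * z + b)\<^sup>2 - (b\<^sup>2 + 4 * a * c) = 4 * a * (a * z\<^sup>2 + b * z - c)"
    by (simp add: power2_eq_square algebra_simps)
  have "0 < \<nu> \<and> \<nu> \<le> z \<and> a * \<nu>\<^sup>2 + b * \<nu> = c \<and> 0 \<le> 2 * a * \<nu> + b"
  proof (cases "a = 0")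
    case True
    then have "0 < b * z" using z(2) c by simp
    then have "0 < b" using z(1) by (simp add: zero_less_mult_iff)
    then show ?thesis using True c z by (simp add: \<nu>_def divide_simps mult.commute)
  next
    case a: False
    have "0 \<le> b\<^sup>2 + 4 * a * c"
    proof (cases "a > 0")
      case False
      then have "4 * a \<le> 0" by simp
      from mult_nonpos_nonneg[OF this z(2)] have "4 * a * (a * z\<^sup>2 + b * z - c) \<le> 0" .
      then show ?thesis using disc zero_le_power2[of "2 * a * z + b"] by linarith
    qed (use c in simp)
    then have s: "s\<^sup>2 = b\<^sup>2 + 4 * a * c" "0 \<le> s" by (auto simp: s_def)
    have \<nu>: "2 * a * \<nu> + b = s" using a by (simp add: \<nu>_def s_def[symmetric])
    have "4 * a * (a * \<nu>\<^sup>2 + b * \<nu> - c) = (2 * a * \<nu> + b)\<^sup>2 - (b\<^sup>2 + 4 * a * c)"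
      by (simp add: power2_eq_square algebra_simps)
    then have root: "a * \<nu>\<^sup>2 + b * \<nu> = c" using \<nu> s a by simp
    consider "a > 0" | "a < 0" using a by linarith
    then have "0 < \<nu> \<and> \<nu> \<le> z"
    proof cases
      case 1
      have "\<bar>b\<bar>\<^sup>2 < s\<^sup>2" using 1 c by (simp add: s(1))
      then have "\<bar>b\<bar> < s" using s(2) by (rule power2_less_imp_less)
      then have "0 < 2 * a * \<nu>" using \<nu> by linarith
      then have "0 < \<nu>" using 1 by (simp add: zero_less_mult_iff)
      have "0 \<le> 4 * a * (a * z\<^sup>2 + b * z - c)"
        using 1 z(2) by (intro mult_nonneg_nonneg) auto
      then have "(2 * a * \<nu> + b)\<^sup>2 \<le> (2 * a * z + b)\<^sup>2"
        unfolding \<nu> s(1) using disc by linarith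
      then have "\<bar>2 * a * \<nu> + b\<bar> \<le> \<bar>2 * a * z + b\<bar>" by (simp only: abs_le_square_iff)
      moreover have "0 < 2 * a * z" using 1 z(1) by simp
      then have "- s < 2 * a * z + b" using \<open>\<bar>b\<bar> < s\<close> by linarith
      ultimately have "2 * a * \<nu> + b \<le> 2 * a * z + b" using \<nu> s(2) by linarith
      with \<open>0 < \<nu>\<close> show ?thesis using 1 by simp
    next
      case 2
      have "a * z\<^sup>2 \<le> 0" using 2 by (simp add: mult_nonpos_nonneg)
      then have "0 < b * z" using z(2) c by linarith
      then have b: "0 < b" using z(1) by (simp add: zero_less_mult_iff)
      have "s\<^sup>2 < b\<^sup>2" using 2 c by (simp add: s(1) mult_neg_pos)
      then have "s < b" using less_imp_le[OF b] by (rule power2_less_imp_less)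
      then have "2 * a * \<nu> < 0" using \<nu> by linarith
      then have "0 < \<nu>" using 2 by (simp add: mult_less_0_iff)
      have "4 * a \<le> 0" using 2 by simp
      from mult_nonpos_nonneg[OF this z(2)] have "4 * a * (a * z\<^sup>2 + b * z - c) \<le> 0" .
      then have "(2 * a * z + b)\<^sup>2 \<le> s\<^sup>2" unfolding s(1) using disc by linarith
      then have "2 * a * z + b \<le> 2 * a * \<nu> + b"
        unfolding \<nu> by (rule power2_le_imp_le[OF _ s(2)])
      with \<open>0 < \<nu>\<close> show ?thesis using 2 by simp
    qed
    with root \<nu> s(2) show ?thesis by simp
  qed
  then show "0 < \<nu>" "\<nu> \<le> z" "a * \<nu>\<^sup>2 + b * \<nu> = c" "0 \<le> 2 * a * \<nu> + b" by auto
qed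


lemma D_min_moments_three_point:
  fixes p \<mu> \<nu> f1 f2 f3 :: real
  defines "m \<equiv> f2 * p + f3"
  defines "a \<equiv> - \<mu> * (p - \<mu>) * (1 - \<mu>)"
    and "b \<equiv> (f2 * p\<^sup>2 + f3 - 2 * \<mu> * m + \<mu>\<^sup>2) + (- \<mu> + (p - \<mu>) + (1 - \<mu>)) * (\<mu> - m)"
  assumes p: "0 < p" "p < 1" and f: "0 \<le> f1" "0 \<le> f2" "0 \<le> f3" "f1 + f2 + f3 = 1"
    and \<mu>: "m < \<mu>" "\<mu> < 1" and d: "3 \<le> d"
    and \<nu>: "0 < \<nu>" "(1 - \<mu>) * \<nu> \<le> 1" "a * \<nu>\<^sup>2 + b * \<nu> = \<mu> - m" "0 \<le> 2 * a * \<nu> + b"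
    and moments: "\<And>k. k \<in> {1..d} \<Longrightarrow> f2 * p ^ k + f3 = M k"
  shows "D_min_moments d M \<mu> = ereal f1 * elog (1 - (- \<mu>) * \<nu>) +
           ereal f2 * elog (1 - (p - \<mu>) * \<nu>) + ereal f3 * elog (1 - (1 - \<mu>) * \<nu>)"
proof -
  define e1 e2 e3 where e: "e1 = 1 - (- \<mu>) * \<nu>" "e2 = 1 - (p - \<mu>) * \<nu>" "e3 = 1 - (1 - \<mu>) * \<nu>"
  have "0 \<le> m" unfolding m_def using p f by simp
  then have "0 < \<mu>" using \<mu> by simp
  have "(p - \<mu>) * \<nu> < (1 - \<mu>) * \<nu>" using p \<nu>(1) by (intro mult_strict_right_mono) auto
  then have "(p - \<mu>) * \<nu> < 1" using \<nu>(2) by linarith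
  then have e_pos: "0 < e1" "0 < e2" "0 \<le> e3"
    using \<nu>(1,2) \<open>0 < \<mu>\<close> by (auto simp: e add_pos_pos)
  define h where "h = e1 * e2 - f1 * e2 - f2 * e1"
  define g1 g2 g3 where g: "g1 = f1 / e1" "g2 = f2 / e2" "g3 = h / (e1 * e2)"
  have f1: "f1 = 1 - f2 - f3" using f(4) by simp
  have "f1 * e2 * e3 + f2 * e1 * e3 + f3 * e1 * e2 - e1 * e2 * e3 = \<nu> * (a * \<nu>\<^sup>2 + b * \<nu> - (\<mu> - m))"
    unfolding f1 e a_def b_def m_def by (simp add: power2_eq_square algebra_simps)
  also have "\<dots> = 0" using \<nu>(3) by simp
  finally have f3: "f3 * (e1 * e2) = h * e3" by (simp add: h_def algebra_simps)
  have "0 \<le> h"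
  proof (cases "e3 = 0")
    case True
    then have f30: "f3 = 0" using f3 e_pos by simp
    define r where "r = (m - \<mu>) - \<nu> * (- \<mu>) * (p - \<mu>)"
    have "2 * a * \<nu> + b = - (1 - \<mu>) * r - e3 * ((- \<mu>) * (p - \<mu>))"
      unfolding a_def b_def m_def r_def e f30 by (simp add: power2_eq_square algebra_simps)
    then have "0 \<le> - (1 - \<mu>) * r" using True \<nu>(4) by simp
    then have "r \<le> 0" using \<mu> by (simp add: zero_le_mult_iff)
    moreover have "h = - \<nu> * r"
      unfolding h_def f1 m_def r_def e f30 by (simp add: algebra_simps)
    ultimately show ?thesis using \<nu>(1) by (simp add: mult_le_0_iff)
  next
    case False
    then have "0 < e3" using e_pos by simp
    moreover have "0 \<le> h * e3" using f3 f e_pos by (metis mult_nonneg_nonneg less_imp_le)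
    ultimately show ?thesis by (simp add: zero_le_mult_iff)
  qed
  then have g0: "0 \<le> g1" "0 \<le> g2" "0 \<le> g3" using f e_pos by (auto simp: g)
  have fg: "f1 = g1 * e1" "f2 = g2 * e2" "f3 = g3 * e3"
    using e_pos f3 by (auto simp: g nonzero_eq_divide_eq)
  have g_sum: "g1 + g2 + g3 = 1"
    using e_pos by (simp add: g h_def divide_simps)
  define w where "w = (\<lambda>(u::real) v t x. if x = 0 then u else if x = p then v else (t::real))"
  have w: "w u v t 0 = u" "w u v t p = v" "w u v t 1 = t" for u v t
    using p by (auto simp: w_def)
  have sum3: "(\<Sum>x\<in>{0, p, 1}. F x) = F 0 + F p + F 1" for F :: "real \<Rightarrow> real"
    using p by simp
  have "D_min_moments d M \<mu> = ereal (\<Sum>x\<in>{0, p, 1}. w f1 f2 f3 x * ln (1 - (x - \<mu>) * \<nu>))"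
  proof (rule D_min_moments_saddle[where g = "w g1 g2 g3" and D = "{p}"])
    show "card {0, p, 1} + card {p} \<le> Suc d" using p d by simp
    show "poly (nodal_poly {0, p, 1} {p}) x \<le> 0" if "x \<in> {0..1}" for x
    proof -
      have "poly (nodal_poly {0, p, 1} {p}) x = (x - p)\<^sup>2 * x * (x - 1)"
        using p by (simp add: poly_nodal_poly power2_eq_square)
      also have "\<dots> \<le> 0" using that by (intro mult_nonneg_nonpos) auto
      finally show ?thesis .
    qed
    show "0 \<le> w g1 g2 g3 x" if "x \<in> {0, p, 1}" for x using that g0 w by auto
    show "w f1 f2 f3 x = w g1 g2 g3 x * (1 - (x - \<mu>) * \<nu>)" if "x \<in> {0, p, 1}" for x
      using that fg w by (auto simp: e)
    show "(\<Sum>x\<in>{0, p, 1}. w g1 g2 g3 x) = 1" "(\<Sum>x\<in>{0, p, 1}. w f1 f2 f3 x) = 1"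
      using f(4) g_sum by (simp_all only: sum3 w)
    show "(\<Sum>x\<in>{0, p, 1}. w f1 f2 f3 x * x ^ k) = M k" if "k \<in> {1..d}" for k
      using moments[OF that] that by (simp only: sum3 w) (simp add: power_0_left)
  qed (use p \<mu> \<nu> in auto)
  also have "\<dots> = ereal (f1 * ln e1 + f2 * ln e2 + f3 * ln e3)"
    by (simp only: sum3 w) (simp add: e)
  also have "\<dots> = ereal f1 * elog e1 + ereal f2 * elog e2 + ereal f3 * elog e3"
  proof -
    have "0 < e3 \<or> f3 = 0" using fg(3) e_pos(3) by auto
    then show ?thesis using e_pos by (simp add: ereal_times_elog)
  qed
  finally show ?thesis by (simp only: e)
qed

section \<open>Moment inequalities\<close>

lemma moment_class_first_nonneg:
  assumes "F \<in> moment_class d M" "1 \<le> d"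
  shows "0 \<le> M 1"
proof -
  have "\<forall>k\<in>{1..d}. (\<integral>x. x ^ k \<partial>F) = M k" using assms(1) by (simp add: moment_class_def)
  then have "(\<integral>x. x ^ 1 \<partial>F) = M 1" by (rule bspec) (use assms(2) in simp)
  then show ?thesis
    using integral_poly_nonneg[of F "[:0, 1:]"] assms(1) by (simp add: moment_class_def)
qed

lemma moment_class_2:
  assumes "F \<in> moment_class 2 M"
  shows "M 2 \<le> M 1" "(M 1)\<^sup>2 \<le> M 2"
proof -
  have S: "(\<Sum>k=1..2. u k) = u 1 + u 2" for u :: "nat \<Rightarrow> real" by (simp add: numeral_2_eq_2)
  note nn = moments_poly_nonneg[OF assms, unfolded S]
  have "0 \<le> x * (1 - x)" if "x \<in> {0..1}" for x :: real using that by simp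
  then show "M 2 \<le> M 1"
    using nn[of "[:0, 1, - 1:]"] by (simp add: numeral_2_eq_2 algebra_simps)
  have "0 \<le> (x - M 1)\<^sup>2" for x by simp
  then show "(M 1)\<^sup>2 \<le> M 2"
    using nn[of "[:(M 1)\<^sup>2, - 2 * M 1, 1:]"] by (simp add: numeral_2_eq_2 algebra_simps)
qed

lemma moment_class_3:
  assumes "F \<in> moment_class 3 M"
  shows "M 2 \<le> M 1" "M 3 \<le> M 2" "2 * M 2 \<le> M 1 + M 3"
    and "M 1 < 1 \<Longrightarrow> (M 1 - M 2)\<^sup>2 \<le> (M 2 - M 3) * (1 - M 1)"
    and "0 < M 1 \<Longrightarrow> (M 1 - M 2)\<^sup>2 \<le> (M 1 - 2 * M 2 + M 3) * M 1"
proof -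
  have S: "(\<Sum>k=1..3. u k) = u 1 + u 2 + u 3" for u :: "nat \<Rightarrow> real"
    by (simp add: numeral_3_eq_3 numeral_2_eq_2)
  note nn = moments_poly_nonneg[OF assms, unfolded S]
  have "0 \<le> x * (1 - x)" if "x \<in> {0..1}" for x :: real using that by simp
  then show "M 2 \<le> M 1"
    using nn[of "[:0, 1, - 1:]"] by (simp add: eval_nat_numeral algebra_simps)
  have A: "0 \<le> t\<^sup>2 * M 1 - 2 * t * M 2 + M 3" for t
  proof -
    have "0 \<le> x * (x - t)\<^sup>2" if "x \<in> {0..1}" for x :: real using that by simp
    then show ?thesis
      using nn[of "[:0, t\<^sup>2, - 2 * t, 1:]"] by (simp add: eval_nat_numeral algebra_simps)
  qed
  have B: "0 \<le> t\<^sup>2 - (2 * t + t\<^sup>2) * M 1 + (1 + 2 * t) * M 2 - M 3" for t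
  proof -
    have "0 \<le> (1 - x) * (x - t)\<^sup>2" if "x \<in> {0..1}" for x :: real using that by simp
    then show ?thesis
      using nn[of "[:t\<^sup>2, - (2 * t + t\<^sup>2), 1 + 2 * t, - 1:]"]
      by (simp add: eval_nat_numeral algebra_simps)
  qed
  show "M 3 \<le> M 2" using B[of 0] by simp
  show "2 * M 2 \<le> M 1 + M 3" using A[of 1] by simp
  show "(M 1 - M 2)\<^sup>2 \<le> (M 2 - M 3) * (1 - M 1)" if "M 1 < 1"
  proof -
    define t where "t = (M 1 - M 2) / (1 - M 1)"
    have t: "M 1 - M 2 = t * (1 - M 1)" using that by (simp add: t_def)
    have "0 \<le> M 2 - M 3 - 2 * t * (M 1 - M 2) + t\<^sup>2 * (1 - M 1)"
      using B[of t] by (simp add: algebra_simps)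
    then have "t\<^sup>2 * (1 - M 1) \<le> M 2 - M 3" unfolding t by (simp add: power2_eq_square)
    then have "t\<^sup>2 * (1 - M 1) * (1 - M 1) \<le> (M 2 - M 3) * (1 - M 1)"
      using that by (intro mult_right_mono) auto
    then show ?thesis unfolding t by (simp add: power2_eq_square mult_ac)
  qed
  show "(M 1 - M 2)\<^sup>2 \<le> (M 1 - 2 * M 2 + M 3) * M 1" if "0 < M 1"
  proof -
    define t where "t = (M 1 - M 2) / M 1"
    have t: "M 1 - M 2 = t * M 1" using that by (simp add: t_def)
    have "0 \<le> (M 1 - 2 * M 2 + M 3) - 2 * t * (M 1 - M 2) + t\<^sup>2 * M 1"
      using A[of "1 - t"] by (simp add: power2_eq_square algebra_simps)
    then have "t\<^sup>2 * M 1 \<le> M 1 - 2 * M 2 + M 3" unfolding t by (simp add: power2_eq_square)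
    then have "t\<^sup>2 * M 1 * M 1 \<le> (M 1 - 2 * M 2 + M 3) * M 1"
      using that by (intro mult_right_mono) auto
    then show ?thesis unfolding t by (simp add: power2_eq_square mult_ac)
  qed
qed

theorem theorem4:
  fixes d :: nat and M :: "nat \<Rightarrow> real" and \<mu> :: real
  assumes "d \<in> {1, 2, 3}"
    and "moment_class d M \<noteq> {}"
    and "M 1 < \<mu>" and "\<mu> < 1"
  shows
    "let D1 = ereal (1 - M 1) * elog ((1 - M 1) / (1 - \<mu>)) + ereal (M 1) * elog (M 1 / \<mu>)
     in
       (d = 1 \<longrightarrow> D_min_moments 1 M \<mu> = D1) \<and>
       (d = 2 \<longrightarrow>
         (let \<nu> = (1 - M 1) * (M 1 - \<mu>) / ((1 - M 1) * \<mu>\<^sup>2 - (1 - M 2) * \<mu> + M 1 - M 2)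
          in D_min_moments 2 M \<mu> =
               ereal ((1 - M 1)\<^sup>2 / (1 - 2 * M 1 + M 2))
                 * elog (1 - ((M 1 - M 2) / (1 - M 1) - \<mu>) * \<nu>)
             + ereal ((M 2 - (M 1)\<^sup>2) / (1 - 2 * M 1 + M 2))
                 * elog (1 - (1 - \<mu>) * \<nu>))) \<and>
       (d = 3 \<longrightarrow>
         (if M 1 = M 2 \<and> M 2 = M 3
          then D_min_moments 3 M \<mu> = D_min_moments 1 M \<mu> \<and> D_min_moments 3 M \<mu> = D1
          else
            (let x1 = - \<mu>;
                 x2 = (M 2 - M 3) / (M 1 - M 2) - \<mu>;
                 x3 = 1 - \<mu>;
                 f2 = (M 1 - M 2) ^ 3 / ((M 2 - M 3) * (M 1 - 2 * M 2 + M 3));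
                 f3 = (M 1 * M 3 - (M 2)\<^sup>2) / (M 1 - 2 * M 2 + M 3);
                 f1 = 1 - f2 - f3;
                 a = x1 * x2 * x3;
                 b = (M 2 - 2 * \<mu> * M 1 + \<mu>\<^sup>2) + (x1 + x2 + x3) * (\<mu> - M 1);
                 c = \<mu> - M 1;
                 \<nu> = (if a \<noteq> 0 then (- b + sqrt (b\<^sup>2 + 4 * a * c)) / (2 * a) else c / b)
             in D_min_moments 3 M \<mu> =
                  ereal f1 * elog (1 - x1 * \<nu>)
                + ereal f2 * elog (1 - x2 * \<nu>)
                + ereal f3 * elog (1 - x3 * \<nu>))))"
proof -
  obtain F where F: "F \<in> moment_class d M" using assms(2) by auto
  have d: "1 \<le> d" using assms(1) by auto
  have M1: "0 \<le> M 1" by (rule moment_class_first_nonneg[OF F d])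
  define D1 where "D1 = ereal (1 - M 1) * elog ((1 - M 1) / (1 - \<mu>)) + ereal (M 1) * elog (M 1 / \<mu>)"
  have two_atoms: "D_min_moments k M \<mu> = D1" if "1 \<le> k" and eq: "\<And>j. j \<in> {1..k} \<Longrightarrow> M j = M 1" for k
  proof -
    have "(1 - M 1) / (1 - 0) * 0 ^ j + (M 1 - 0) / (1 - 0) = M j" if "j \<in> {1..k}" for j
      using that by (subst eq) auto
    from D_min_moments_two_point[OF order_refl M1 assms(3,4) _ _ _ this, of "{}"] \<open>1 \<le> k\<close>
    show ?thesis by (simp add: D1_def)
  qed
  have d1: "D_min_moments 1 M \<mu> = D1" by (rule two_atoms) auto
  have d2: "D_min_moments 2 M \<mu> =
      ereal ((1 - M 1)\<^sup>2 / (1 - 2 * M 1 + M 2)) * elog (1 - ((M 1 - M 2) / (1 - M 1) - \<mu>) * \<nu>) +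
      ereal ((M 2 - (M 1)\<^sup>2) / (1 - 2 * M 1 + M 2)) * elog (1 - (1 - \<mu>) * \<nu>)"
    if "d = 2" and \<nu>: "\<nu> = (1 - M 1) * (M 1 - \<mu>) / ((1 - M 1) * \<mu>\<^sup>2 - (1 - M 2) * \<mu> + M 1 - M 2)" for \<nu>
  proof -
    note M = moment_class_2[OF F[unfolded \<open>d = 2\<close>]]
    define p where "p = (M 1 - M 2) / (1 - M 1)"
    have m: "M 1 < 1" using assms by simp
    have M2: "M 2 = M 1 - p * (1 - M 1)" using m by (simp add: p_def)
    have p: "0 \<le> p" "p \<le> M 1"
      using M m by (auto simp: p_def divide_simps power2_eq_square algebra_simps)
    have p1: "p < 1" "p < \<mu>" using p assms by auto
    have "1 - 2 * M 1 + M 2 = (1 - M 1) * (1 - p)" unfolding M2 by (simp add: algebra_simps)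
    moreover have "M 2 - (M 1)\<^sup>2 = (1 - M 1) * (M 1 - p)"
      unfolding M2 by (simp add: power2_eq_square algebra_simps)
    ultimately have w: "(1 - M 1)\<^sup>2 / (1 - 2 * M 1 + M 2) = (1 - M 1) / (1 - p)"
      "(M 2 - (M 1)\<^sup>2) / (1 - 2 * M 1 + M 2) = (M 1 - p) / (1 - p)"
      using m by (simp_all add: power2_eq_square)
    have "(1 - M 1) * \<mu>\<^sup>2 - (1 - M 2) * \<mu> + M 1 - M 2 = (1 - M 1) * ((1 - \<mu>) * (p - \<mu>))"
      unfolding M2 by (simp add: power2_eq_square algebra_simps)
    then have "\<nu> = (M 1 - \<mu>) / ((1 - \<mu>) * (p - \<mu>))" using m \<nu> by simp
    then have "1 - (p - \<mu>) * \<nu> = (1 - M 1) / (1 - \<mu>)" "1 - (1 - \<mu>) * \<nu> = (M 1 - p) / (\<mu> - p)"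
      using p1 assms(4) by (simp_all add: divide_simps) (simp_all add: algebra_simps)
    moreover have "D_min_moments 2 M \<mu> =
           ereal ((1 - M 1) / (1 - p)) * elog ((1 - M 1) / (1 - \<mu>)) +
           ereal ((M 1 - p) / (1 - p)) * elog ((M 1 - p) / (\<mu> - p))"
    proof (rule D_min_moments_two_point[where D = "{p}"])
      fix k :: nat assume "k \<in> {1..2}"
      then consider "k = 1" | "k = 2" by force
      then show "(1 - M 1) / (1 - p) * p ^ k + (M 1 - p) / (1 - p) = M k"
        by cases (use p1 in \<open>simp_all add: M2 divide_simps\<close>, simp_all add: power2_eq_square algebra_simps)
    qed (use p assms in auto)
    ultimately show ?thesis by (simp only: w p_def[symmetric])
  qed
  have d3: "D_min_moments 3 M \<mu> =
      ereal (1 - f2 - f3) * elog (1 - x1 * \<nu>) + ereal f2 * elog (1 - x2 * \<nu>) + ereal f3 * elog (1 - x3 * \<nu>)"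
    if "d = 3" "\<not> (M 1 = M 2 \<and> M 2 = M 3)"
      and x: "x1 = - \<mu>" "x2 = (M 2 - M 3) / (M 1 - M 2) - \<mu>" "x3 = 1 - \<mu>"
      and f: "f2 = (M 1 - M 2) ^ 3 / ((M 2 - M 3) * (M 1 - 2 * M 2 + M 3))"
        "f3 = (M 1 * M 3 - (M 2)\<^sup>2) / (M 1 - 2 * M 2 + M 3)"
      and abc: "a = x1 * x2 * x3"
        "b = (M 2 - 2 * \<mu> * M 1 + \<mu>\<^sup>2) + (x1 + x2 + x3) * (\<mu> - M 1)" "c = \<mu> - M 1"
      and \<nu>: "\<nu> = (if a \<noteq> 0 then (- b + sqrt (b\<^sup>2 + 4 * a * c)) / (2 * a) else c / b)"
    for x1 x2 x3 f2 f3 a b c \<nu>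
  proof -
    note M = moment_class_3[OF F[unfolded \<open>d = 3\<close>]]
    have m: "M 1 < 1" using assms by simp
    define u v where uv: "u = M 1 - M 2" "v = M 2 - M 3"
    have u: "0 < u" using M(1-3) that(2) by (auto simp: uv)
    have M3: "M 2 = M 1 - u" "M 3 = M 1 - u - v" by (auto simp: uv)
    have M1': "0 < M 1"
    proof (rule ccontr)
      assume "\<not> 0 < M 1"
      then have "M 1 = 0" using M1 by simp
      have "(\<integral>x. x ^ 2 \<partial>F) = M 2" using F \<open>d = 3\<close> by (simp add: moment_class_def)
      moreover have "0 \<le> (\<integral>x. x ^ 2 \<partial>F)" by simp
      ultimately show False using u \<open>M 1 = 0\<close> by (simp add: uv)
    qed
    have uv': "M 1 - 2 * M 2 + M 3 = u - v" by (simp add: uv)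
    have Bu: "u\<^sup>2 \<le> v * (1 - M 1)" and Au: "u\<^sup>2 \<le> (u - v) * M 1"
      using M(4)[OF m] M(5)[OF M1'] unfolding uv' by (simp_all add: uv)
    have "0 < v * (1 - M 1)" "0 < (u - v) * M 1"
      using u less_le_trans[OF _ Bu] less_le_trans[OF _ Au] by simp_all
    then have v: "0 < v" "v < u" using m M1' by (simp_all add: zero_less_mult_iff)
    define p where "p = v / u"
    have p: "0 < p" "p < 1" using u v by (auto simp: p_def)
    have vp: "v = p * u" using u by (simp add: p_def)
    have f2: "f2 = u / (p * (1 - p))"
    proof -
      have "f2 = u ^ 3 / (v * (u - v))" unfolding f uv' by (simp add: uv)
      also have "v * (u - v) = p * (1 - p) * u\<^sup>2" unfolding vp by (simp add: power2_eq_square algebra_simps)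
      also have "u ^ 3 / (p * (1 - p) * u\<^sup>2) = u / (p * (1 - p))"
        using u by (simp add: power2_eq_square power3_eq_cube)
      finally show ?thesis .
    qed
    have f3: "f3 = M 1 - f2 * p"
    proof -
      have "M 1 * M 3 - (M 2)\<^sup>2 = M 1 * (u - v) - u\<^sup>2"
        unfolding M3 by (simp add: power2_eq_square algebra_simps)
      then have "f3 = (M 1 * (u - v) - u\<^sup>2) / (u - v)" unfolding f uv' by simp
      also have "\<dots> = M 1 - u\<^sup>2 / (u - v)" using v by (simp add: diff_divide_distrib)
      also have "u - v = u * (1 - p)" unfolding vp by (simp add: algebra_simps)
      finally show ?thesis using u p unfolding f2 by (simp add: power2_eq_square)
    qed
    have f2': "f2 * (p * (1 - p)) = u" using p unfolding f2 by simp
    have f3_nn: "0 \<le> f3"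
    proof -
      have "u * u \<le> u * ((1 - p) * M 1)" using Au unfolding vp by (simp add: power2_eq_square algebra_simps)
      then have "u \<le> (1 - p) * M 1" using u by simp
      then have "f2 * p \<le> M 1" using p unfolding f2 by (simp add: divide_simps mult.commute)
      then show ?thesis using f3 by simp
    qed
    have f1_nn: "0 \<le> 1 - f2 - f3"
    proof -
      have "u * u \<le> u * (p * (1 - M 1))" using Bu unfolding vp by (simp add: power2_eq_square algebra_simps)
      then have "u \<le> p * (1 - M 1)" using u by simp
      then have "f2 * (1 - p) \<le> 1 - M 1" using p unfolding f2 by (simp add: divide_simps mult.commute)
      then show ?thesis using f3 by (simp add: algebra_simps)
    qed
    have f2_nn: "0 \<le> f2" using p u unfolding f2 by simp
    have mom: "M 1 = f2 * p + f3" "M 2 = f2 * p\<^sup>2 + f3" "M 3 = f2 * p ^ 3 + f3"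
    proof -
      show "M 1 = f2 * p + f3" using f3 by simp
      show "M 2 = f2 * p\<^sup>2 + f3"
        using f2' unfolding M3 f3 by (simp add: power2_eq_square algebra_simps)
      have "f2 * p - f2 * p ^ 3 = f2 * (p * (1 - p)) + p * (f2 * (p * (1 - p)))"
        by (simp add: power3_eq_cube algebra_simps)
      then show "M 3 = f2 * p ^ 3 + f3" unfolding f2' unfolding M3 f3 vp by simp
    qed
    have x2: "x2 = p - \<mu>" by (simp add: x p_def uv)
    note xs = x(1) x2 x(3)
    have q: "0 \<le> a * (1 / (1 - \<mu>))\<^sup>2 + b * (1 / (1 - \<mu>)) - c"
    proof -
      have clear: "(a * (1 / y)\<^sup>2 + b * (1 / y) - c) * y\<^sup>2 = a + b * y - c * y\<^sup>2" if "y \<noteq> 0" for y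
        using that by (simp add: power2_eq_square field_simps)
      have "(a * (1 / (1 - \<mu>))\<^sup>2 + b * (1 / (1 - \<mu>)) - c) * (1 - \<mu>)\<^sup>2
          = a + b * (1 - \<mu>) - c * (1 - \<mu>)\<^sup>2"
        using assms(4) by (intro clear) simp
      also have "\<dots> = f3 * (1 - \<mu>) * (1 - p)"
        unfolding abc xs mom by (simp add: power2_eq_square algebra_simps)
      also have "0 \<le> \<dots>" using f3_nn p assms(4) by simp
      finally show ?thesis using assms(4) by (simp add: zero_le_mult_iff)
    qed
    have "0 < c" "0 < 1 / (1 - \<mu>)" using assms by (auto simp: abc)
    note root = quadratic_root_bounds[OF this q, folded \<nu>]
    have "D_min_moments 3 M \<mu> =
      ereal (1 - f2 - f3) * elog (1 - (- \<mu>) * \<nu>) + ereal f2 * elog (1 - (p - \<mu>) * \<nu>) + ereal f3 * elog (1 - (1 - \<mu>) * \<nu>)"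
    proof (rule D_min_moments_three_point)
      show "(1 - \<mu>) * \<nu> \<le> 1" using root(2) assms(4) by (simp add: field_simps)
      show "f2 * p ^ k + f3 = M k" if "k \<in> {1..3}" for k
      proof -
        from that consider "k = 1" | "k = 2" | "k = 3" by force
        then show ?thesis by cases (use mom in simp_all)
      qed
      have a: "a = - \<mu> * (p - \<mu>) * (1 - \<mu>)" by (simp add: abc xs)
      have b: "b = (f2 * p\<^sup>2 + f3 - 2 * \<mu> * (f2 * p + f3) + \<mu>\<^sup>2) +
          (- \<mu> + (p - \<mu>) + (1 - \<mu>)) * (\<mu> - (f2 * p + f3))"
        unfolding abc xs mom ..
      show "- \<mu> * (p - \<mu>) * (1 - \<mu>) * \<nu>\<^sup>2 + ((f2 * p\<^sup>2 + f3 - 2 * \<mu> * (f2 * p + f3) + \<mu>\<^sup>2) +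
          (- \<mu> + (p - \<mu>) + (1 - \<mu>)) * (\<mu> - (f2 * p + f3))) * \<nu> = \<mu> - (f2 * p + f3)"
        using root(3) unfolding a b abc(3) mom(1) .
      show "0 \<le> 2 * (- \<mu> * (p - \<mu>) * (1 - \<mu>)) * \<nu> +
         ((f2 * p\<^sup>2 + f3 - 2 * \<mu> * (f2 * p + f3) + \<mu>\<^sup>2) +
          (- \<mu> + (p - \<mu>) + (1 - \<mu>)) * (\<mu> - (f2 * p + f3)))"
        using root(4) unfolding a b .
      show "f2 * p + f3 < \<mu>" using assms(3) mom(1) by simp
    qed (use p f1_nn f2_nn f3_nn root(1) assms in auto)
    then show ?thesis by (simp only: xs)
  qed
  have d3': "D_min_moments 3 M \<mu> = D1" if "M 1 = M 2 \<and> M 2 = M 3"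
  proof (rule two_atoms)
    fix k :: nat assume "k \<in> {1..3}"
    then consider "k = 1" | "k = 2" | "k = 3" by force
    then show "M k = M 1" by cases (use that in auto)
  qed simp
  show ?thesis
    unfolding Let_def D1_def[symmetric]
  proof (intro conjI impI, goal_cases)
    case 1
    show ?case by (rule d1)
  next
    case 2
    show ?case by (rule d2[OF 2 refl])
  next
    case 3
    show ?case
    proof (cases "M 1 = M 2 \<and> M 2 = M 3")
      case True
      show ?thesis unfolding if_P[OF True] d1 d3'[OF True] by simp
    next
      case False
      show ?thesis
        unfolding if_not_P[OF False] by (rule d3[OF 3 False]) (rule refl)+
    qed
  qed
qed

end
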